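(* For any $\lambda\in(0,1)$ with $\lambda<1/\sqrt3$, the invariant set $\mathcal{S}_\lambda$ has zero (two-dimensional) Lebesgue measure.
   Context: Let $\mathbf p_k=\frac23(\cos(2\pi k/3),\sin(2\pi k/3))\in\mathbb{R}^2$, $k=0,1,2$. For $\lambda\in(0,1)$ let $f_i(\mathbf x)=\lambda\mathbf x+(1-\lambda)\mathbf p_i$, $i=0,1,2$. The invariant set $\mathcal{S}_\lambda$ is the unique non-empty compact set with $\mathcal{S}_\lambda=\bigcup_{i=0}^2 f_i(\mathcal{S}_\lambda)$. *)

theory Defs
  imports "HOL-Analysis.Analysis"
begin

definition vertex :: "nat \<Rightarrow> real ^ 2" where
  "vertex k = (2 / 3) *\<^sub>R vector [cos (2 * pi * real k / 3), sin (2 * pi * real k / 3)]"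

definition ifs_map :: "real \<Rightarrow> nat \<Rightarrow> real ^ 2 \<Rightarrow> real ^ 2" where
  "ifs_map l i x = l *\<^sub>R x + (1 - l) *\<^sub>R vertex i"

text \<open>The description is meaningful for \<open>0 < l < 1\<close>: the maps \<open>ifs_map l i\<close> are then
  contractions, so by Hutchinson's theorem there is exactly one such set.\<close>

definition invariant_set :: "real \<Rightarrow> (real ^ 2) set" where
  "invariant_set l = (THE S. S \<noteq> {} \<and> compact S \<and> S = (\<Union>i\<in>{0..2}. ifs_map l i ` S))"

end

theory Submission
  imports Defs
begin

text \<open>
  The set \<open>S\<close> is covered by three copies of itself scaled by \<open>l\<close>, so its area \<open>m\<close>
  satisfies \<open>m \<le> 3 * l\<^sup>2 * m\<close>. Since \<open>S\<close> is compact, \<open>m\<close> is finite, and \<open>3 * l\<^sup>2 < 1\<close>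
  then forces \<open>m = 0\<close>.

  As the invariant set is given by a definite description, this is only meaningful once
  existence and uniqueness are known. Both are proved for any finite nonempty family of maps
  \<open>x \<mapsto> l x + b i\<close> with common ratio \<open>0 \<le> l < 1\<close> on a Euclidean space.
  Existence (\<open>ex_self_similar\<close>): the orbit of the fixed point of one of the maps is bounded and
  already satisfies the set equation, and the equation survives closure.
  Uniqueness (\<open>self_similar_subset\<close>): if \<open>S\<close> and \<open>T\<close> are two solutions, a point of \<open>S\<close> farthest
  from \<open>T\<close> is the image of a point of \<open>S\<close> under a map that contracts distances to \<open>T\<close>, so the
  maximal distance is \<open>0\<close>.
\<close>

definition self_similar ::
  "real \<Rightarrow> ('i \<Rightarrow> 'a) \<Rightarrow> 'i set \<Rightarrow> 'a::euclidean_space set \<Rightarrow> bool" where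
  "self_similar l b I S \<longleftrightarrow>
    S \<noteq> {} \<and> compact S \<and> S = (\<Union>i\<in>I. (\<lambda>x. l *\<^sub>R x + b i) ` S)"

inductive_set orbit :: "real \<Rightarrow> ('i \<Rightarrow> 'a) \<Rightarrow> 'i set \<Rightarrow> 'a::real_vector \<Rightarrow> 'a set"
  for l b I p where
  base: "p \<in> orbit l b I p"
| step: "x \<in> orbit l b I p \<Longrightarrow> i \<in> I \<Longrightarrow> l *\<^sub>R x + b i \<in> orbit l b I p"

text \<open>The radius \<open>B / (1 - l)\<close> solves \<open>l * R + B = R\<close>, so the ball of that radius is mapped
  into itself.\<close>

lemma bounded_orbit:
  fixes b :: "'i \<Rightarrow> 'a::real_normed_vector"
  assumes "0 \<le> l" "l < 1" "\<And>i. i \<in> I \<Longrightarrow> norm (b i) \<le> B" "norm p \<le> B / (1 - l)"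
  shows "bounded (orbit l b I p)"
proof -
  have "norm x \<le> B / (1 - l)" if "x \<in> orbit l b I p" for x
    using that
  proof induction
    case base
    then show ?case using assms by simp
  next
    case (step x i)
    have "norm (l *\<^sub>R x + b i) \<le> l * norm x + norm (b i)"
      using norm_triangle_ineq[of "l *\<^sub>R x" "b i"] assms by simp
    also have "\<dots> \<le> l * (B / (1 - l)) + B"
      using step assms by (intro add_mono mult_left_mono) auto
    also have "\<dots> = B / (1 - l)"
      using assms by (simp add: field_simps)
    finally show ?case .
  qed
  then show ?thesis by (auto simp: bounded_iff)
qed

lemma closure_affine_image:
  fixes A :: "'a::real_normed_vector set"
  shows "closure ((\<lambda>x. l *\<^sub>R x + b) ` A) = (\<lambda>x. l *\<^sub>R x + b) ` closure A"
proof -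
  have *: "(\<lambda>x. l *\<^sub>R x + b) ` C = (+) b ` (*\<^sub>R) l ` C" for C :: "'a set"
    by (auto simp: image_image add.commute)
  show ?thesis
    by (simp only: * closure_translation closure_scaleR)
qed

lemma ex_self_similar:
  fixes b :: "'i \<Rightarrow> 'a::euclidean_space"
  assumes "0 \<le> l" "l < 1" "finite I" "I \<noteq> {}"
  shows "\<exists>S. self_similar l b I S"
proof -
  obtain k where k: "k \<in> I" using assms by auto
  define p where "p = (1 / (1 - l)) *\<^sub>R b k"
  define B where "B = Max ((\<lambda>i. norm (b i)) ` I)"
  have B: "norm (b i) \<le> B" if "i \<in> I" for i
    unfolding B_def using that assms by auto
  define Q where "Q = orbit l b I p"
  have "norm p \<le> B / (1 - l)"
    using B[OF k] assms by (simp add: p_def divide_right_mono)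
  then have bdd: "bounded Q"
    unfolding Q_def using assms B by (intro bounded_orbit) auto
  have "l *\<^sub>R p + b k = (l / (1 - l) + 1) *\<^sub>R b k"
    by (simp add: p_def scaleR_left_distrib)
  also have "l / (1 - l) + 1 = 1 / (1 - l)"
    using assms by (simp add: field_simps)
  finally have p_fixed: "l *\<^sub>R p + b k = p" by (simp add: p_def)
  have "Q = (\<Union>i\<in>I. (\<lambda>x. l *\<^sub>R x + b i) ` Q)"
  proof (intro equalityI subsetI)
    fix x assume "x \<in> Q"
    then show "x \<in> (\<Union>i\<in>I. (\<lambda>x. l *\<^sub>R x + b i) ` Q)"
      unfolding Q_def
    proof cases
      case base
      \<comment> \<open>The starting point has a preimage in the orbit because it is a fixed point.\<close>
      then have "x = l *\<^sub>R p + b k" using p_fixed by simp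
      then show "x \<in> (\<Union>i\<in>I. (\<lambda>x. l *\<^sub>R x + b i) ` orbit l b I p)"
        using k orbit.base by blast
    next
      case (step y i)
      then show "x \<in> (\<Union>i\<in>I. (\<lambda>x. l *\<^sub>R x + b i) ` orbit l b I p)" by blast
    qed
  qed (auto simp: Q_def intro: orbit.step)
  then have "closure Q = closure (\<Union>i\<in>I. (\<lambda>x. l *\<^sub>R x + b i) ` Q)"
    by simp
  also have "\<dots> = (\<Union>i\<in>I. (\<lambda>x. l *\<^sub>R x + b i) ` closure Q)"
    using \<open>finite I\<close> by (induction I) (simp_all add: closure_affine_image)
  finally have "closure Q = (\<Union>i\<in>I. (\<lambda>x. l *\<^sub>R x + b i) ` closure Q)" .
  moreover have "p \<in> closure Q"
    using closure_subset[of Q] orbit.base[of p] by (auto simp: Q_def)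
  moreover have "compact (closure Q)"
    using bdd by simp
  ultimately show ?thesis
    unfolding self_similar_def by blast
qed

lemma self_similar_subset:
  fixes b :: "'i \<Rightarrow> 'a::euclidean_space"
  assumes "0 \<le> l" "l < 1" and S: "self_similar l b I S" and T: "self_similar l b I T"
  shows "S \<subseteq> T"
proof -
  have "S \<noteq> {}" "compact S" and T': "T \<noteq> {}" "closed T"
    using S T compact_imp_closed by (auto simp: self_similar_def)
  then obtain x where x: "x \<in> S" and max: "\<And>y. y \<in> S \<Longrightarrow> infdist y T \<le> infdist x T"
    using continuous_attains_sup[of S "\<lambda>x. infdist x T"] continuous_on_infdist[OF continuous_on_id]
    by metis
  obtain y i where y: "y \<in> S" and i: "i \<in> I" and xy: "x = l *\<^sub>R y + b i"
    using S x unfolding self_similar_def by blast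
  obtain t where t: "t \<in> T" "infdist y T = dist y t"
    using infdist_attains_inf[OF T'(2,1)] by blast
  have "l *\<^sub>R t + b i \<in> T"
    using T t(1) i unfolding self_similar_def by blast
  then have "infdist x T \<le> dist x (l *\<^sub>R t + b i)"
    by (rule infdist_le)
  also have "\<dots> = l * dist y t"
    using assms by (simp add: xy dist_norm flip: scaleR_diff_right)
  also have "\<dots> \<le> l * infdist x T"
    using assms max[OF y] t by (auto intro: mult_left_mono)
  finally have "(1 - l) * infdist x T \<le> 0"
    by (simp add: algebra_simps)
  then have "infdist x T \<le> 0"
    using assms by (simp add: mult_le_0_iff)
  then have "infdist y T = 0" if "y \<in> S" for y
    using max[OF that] infdist_nonneg[of y T] by linarith
  then show ?thesis
    using T' in_closed_iff_infdist_zero by blast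
qed

lemma ex1_self_similar:
  fixes b :: "'i \<Rightarrow> 'a::euclidean_space"
  assumes "0 \<le> l" "l < 1" "finite I" "I \<noteq> {}"
  shows "\<exists>!S. self_similar l b I S"
  using ex_self_similar[OF assms, of b] self_similar_subset[OF assms(1,2), of b I]
  by (metis subset_antisym)

text \<open>The hypothesis on \<open>l\<close> says that the pieces have smaller total volume than the whole,
  unless that volume is \<open>0\<close>; compactness excludes infinite volume.\<close>

lemma self_similar_null:
  fixes b :: "'i \<Rightarrow> 'a::euclidean_space"
  assumes "0 \<le> l" "finite I" and small: "real (card I) * l ^ DIM('a) < 1"
    and S: "self_similar l b I S"
  shows "S \<in> null_sets lebesgue"
proof -
  let ?f = "\<lambda>i x. l *\<^sub>R x + b i"
  have "compact S" and eq: "S = (\<Union>i\<in>I. ?f i ` S)"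
    using S by (auto simp: self_similar_def)
  have Sm: "S \<in> lmeasurable"
    using \<open>compact S\<close> by (rule lmeasurable_compact)
  have pieces: "?f i ` S \<in> lmeasurable" for i
    using \<open>compact S\<close> by (intro lmeasurable_compact compact_continuous_image continuous_intros)
  have scale: "measure lebesgue (?f i ` S) = l ^ DIM('a) * measure lebesgue S" for i
    using assms by (simp add: measure_def emeasure_lebesgue_affine enn2real_mult)
  have "measure lebesgue S = measure lebesgue (\<Union>i\<in>I. ?f i ` S)"
    using eq by simp
  also have "\<dots> \<le> (\<Sum>i\<in>I. measure lebesgue (?f i ` S))"
    using assms pieces by (intro measure_UNION_le) auto
  also have "\<dots> = real (card I) * l ^ DIM('a) * measure lebesgue S"
    by (simp add: scale)
  finally have "(1 - real (card I) * l ^ DIM('a)) * measure lebesgue S \<le> 0"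
    by (simp add: algebra_simps)
  then have "measure lebesgue S = 0"
    using small measure_nonneg[of lebesgue S] by (simp add: mult_le_0_iff)
  then show ?thesis
    using Sm by (simp add: negligible_iff_measure flip: negligible_iff_null_sets)
qed

theorem proposition4p3:
  fixes l :: real
  assumes "l \<in> {0<..<1}" and "l < 1 / sqrt 3"
  shows "invariant_set l \<in> null_sets lebesgue"
proof -
  let ?b = "\<lambda>i. (1 - l) *\<^sub>R vertex i"
  have l: "0 \<le> l" "l < 1" using assms by auto
  have "invariant_set l = (THE S. self_similar l ?b {0..2} S)"
    by (simp add: invariant_set_def self_similar_def ifs_map_def[abs_def])
  then have "self_similar l ?b {0..2} (invariant_set l)"
    using theI'[OF ex1_self_similar[OF l, of "{0..2::nat}" ?b]] by simp
  moreover have "l\<^sup>2 < (1 / sqrt 3)\<^sup>2"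
    using assms by (intro power_strict_mono) auto
  then have "real (card {0..2::nat}) * l ^ DIM(real ^ 2) < 1"
    by (simp add: power_divide)
  ultimately show ?thesis
    using self_similar_null[OF l(1)] by blast
qed

end
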